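(* Let $\{F_t\}_{t\ge0}$ be a nice Feller process on $\mathbb{R}^d$, $d\ge1$, with symbol $q(x,\xi)$ and Pruitt indices $\beta$ and $\delta$. (i) If $d=1$, the function $\xi\mapsto\sup_{x\in\mathbb{R}}|q(x,\xi)|$ is radial and, as a function of $|\xi|$, convex on some neighborhood $[0,\varepsilon)$ of the origin, and $$\int_{\{|\xi|<r\}}\frac{d\xi}{\sup_{x\in\mathbb{R}}|q(x,\xi)|}=\infty\quad\text{for some } r>0,$$ then $\beta\ge1$. (ii) If the function $\xi\mapsto\sup_{x\in\mathbb{R}^d}|q(x,\xi)|$ is radial and, as a function of $|\xi|$, concave on some neighborhood $[0,\varepsilon)$ of the origin, then $\beta\le1$. (iii) If the function $\xi\mapsto\inf_{x\in\mathbb{R}^d}\operatorname{Re}q(x,\xi)$ is radial and, as a function of $|\xi|$, concave on some neighborhood $[0,\varepsilon)$ of the origin, $d\ge2$ and $\delta<d$, then $$\int_{\{|\xi|<r\}}\frac{d\xi}{\inf_{x\in\mathbb{R}^d}\operatorname{Re}q(x,\xi)}<\infty\quad\text{for some } r>0.$$ (iv) If the function $\xi\mapsto\inf_{x\in\mathbb{R}^d}\operatorname{Re}q(x,\xi)$ is radial and, as a function of $|\xi|$, convex on some neighborhood $[0,\varepsilon)$ of the origin, then $\delta\ge1$.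
   Context: The Pruitt indices of a process with symbol $q$ are $$\beta:=\sup\Big\{\alpha\ge0:\lim_{|\xi|\to0}\frac{\sup_{x\in\mathbb{R}^d}|q(x,\xi)|}{|\xi|^\alpha}=0\Big\},\qquad \delta:=\sup\Big\{\alpha\ge0:\lim_{|\xi|\to0}\frac{\inf_{x\in\mathbb{R}^d}\operatorname{Re}q(x,\xi)}{|\xi|^\alpha}=0\Big\}.$$ A function of $\xi\in\mathbb{R}^d$ is radial if it depends only on $|\xi|$. A Feller process $\{F_t\}_{t\ge0}$ on $\mathbb{R}^d$ is a Markov process with state space $(\mathbb{R}^d,\mathcal{B}(\mathbb{R}^d))$, with laws $\mathbb{P}^x$ and expectations $\mathbb{E}^x$ (starting point $x\in\mathbb{R}^d$), whose semigroup $P_tf(x)=\mathbb{E}^x[f(F_t)]$ maps $C_\infty(\mathbb{R}^d)$ (continuous functions vanishing at infinity, with the supremum norm) into itself and is strongly continuous there; it is strong Markov with càdlàg paths. Let $(\mathcal{A},\mathcal{D}_{\mathcal{A}})$ be its (Feller) generator. Condition (C1): $C_c^\infty(\mathbb{R}^d)\subseteq\mathcal{D}_{\mathcal{A}}$. Under (C1), for $f\in C_c^\infty(\mathbb{R}^d)$, $\mathcal{A}f(x)=-\int_{\mathbb{R}^d}q(x,\xi)e^{i\langle\xi,x\rangle}\hat f(\xi)\,d\xi$ with $\hat f(\xi)=(2\pi)^{-d}\int e^{-i\langle\xi,x\rangle}f(x)\,dx$, where the function $q:\mathbb{R}^d\times\mathbb{R}^d\to\mathbb{C}$, called the symbol,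 has for each $x$ the form $$q(x,\xi)=a(x)-i\langle\xi,b(x)\rangle+\tfrac12\langle\xi,c(x)\xi\rangle-\int_{\mathbb{R}^d}\left(e^{i\langle\xi,y\rangle}-1-i\langle\xi,y\rangle1_{\{|y|\le1\}}\right)\nu(x,dy),$$ with $a\ge0$, $b(x)\in\mathbb{R}^d$, $c(x)$ a symmetric nonnegative definite $d\times d$ matrix (all Borel measurable in $x$) and $\nu(x,dy)$ a Borel kernel (the Lévy measure) with $\nu(x,\{0\})=0$, $\int\min\{1,|y|^2\}\nu(x,dy)<\infty$. Condition (C2): there is $C\ge0$ with $\sup_x|q(x,\xi)|\le C(1+|\xi|^2)$ for all $\xi$. Condition (C3): $q(x,0)=a(x)=0$ for all $x$. The process is $\varphi$-irreducible, for a $\sigma$-finite measure $\varphi$ on $\mathcal{B}(\mathbb{R}^d)$, if $\varphi(B)>0$ implies $\int_0^\infty\mathbb{P}^x(F_t\in B)\,dt>0$ for all $x$; then there is a maximal irreducibility measure $\psi$ (i.e. the process is $\bar\varphi$-irreducible iff $\bar\varphi\ll\psi$). Condition (C4): the process is irreducible and its maximal irreducibility measure $\psi$ satisfies $\psi(O)>0$ for every nonempty open set $O\subseteq\mathbb{R}^d$. A nice Feller process is a Feller process satisfying (C1)-(C4). Convention: $1/0=\infty$ in integrands. *)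

theory Defs
  imports "HOL-Probability.Probability"
begin

section \<open>Test functions\<close>

definition C_infty :: "(real^'n \<Rightarrow> real) set" where
  "C_infty = {f. continuous_on UNIV f \<and> (f \<longlongrightarrow> 0) at_infinity}"

definition partial :: "'n \<Rightarrow> (real^'n \<Rightarrow> real) \<Rightarrow> real^'n \<Rightarrow> real" where
  "partial i f x = frechet_derivative f (at x) (axis i 1)"

primrec Ck :: "nat \<Rightarrow> (real^'n \<Rightarrow> real) \<Rightarrow> bool" where
  "Ck 0 f = continuous_on UNIV f"
| "Ck (Suc k) f = ((\<forall>x. f differentiable at x) \<and> (\<forall>i. Ck k (partial i f)))"

definition Cc_infty :: "(real^'n \<Rightarrow> real) set" where
  "Cc_infty = {f. (\<forall>k. Ck k f) \<and> compact (closure {x. f x \<noteq> 0})}"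

definition fourier :: "(real^'n \<Rightarrow> real) \<Rightarrow> real^'n \<Rightarrow> complex" where
  "fourier f \<xi> = complex_of_real (1 / (2 * pi) ^ CARD('n)) *
     (LINT x|lborel. exp (- (\<i> * complex_of_real (\<xi> \<bullet> x))) * complex_of_real (f x))"

section \<open>Feller processes\<close>

text \<open>
  A process is given by a measurable space \<open>M\<close> (its measure plays no role), the laws \<open>P x\<close> on \<open>M\<close>
  for the starting points \<open>x\<close>, and the maps \<open>F t\<close>, which matter only for \<open>t \<ge> 0\<close>.
  Filtrations are indexed by \<open>[0,\<infinity>]\<close>, i.e. by \<open>ennreal\<close>, so that the stopping times of the library,
  which take values in the index type, may be infinite; the index \<open>\<infinity>\<close> gives the
  \<open>\<sigma>\<close>-algebra generated by the whole process.
\<close>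

definition natural_filtration :: "'w measure \<Rightarrow> (real \<Rightarrow> 'w \<Rightarrow> real^'n) \<Rightarrow> ennreal \<Rightarrow> 'w measure" where
  "natural_filtration M F s =
     sigma (space M) {F u -` B \<inter> space M | u B. 0 \<le> u \<and> ennreal u \<le> s \<and> B \<in> sets borel}"

lemma filtration_natural_filtration: "filtration (space M) (natural_filtration M F)"
proof
  have gen: "{F u -` B \<inter> space M | u B. 0 \<le> u \<and> ennreal u \<le> s \<and> B \<in> sets borel}
      \<subseteq> Pow (space M)" for s
    by auto
  show "space (natural_filtration M F i) = space M" for i
    unfolding natural_filtration_def by (rule space_measure_of[OF gen])
  show "sets (natural_filtration M F i) \<subseteq> sets (natural_filtration M F j)" if "i \<le> j" for i j
    unfolding natural_filtration_def sets_measure_of[OF gen]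
    using that by (intro sigma_sets_mono') (blast intro: order_trans)
qed

definition cadlag :: "(real \<Rightarrow> 'a::topological_space) \<Rightarrow> bool" where
  "cadlag p \<longleftrightarrow> (\<forall>t\<ge>0. (p \<longlongrightarrow> p t) (at_right t)) \<and> (\<forall>t>0. \<exists>l. (p \<longlongrightarrow> l) (at_left t))"

definition markov_process ::
  "'w measure \<Rightarrow> (real^'n \<Rightarrow> 'w measure) \<Rightarrow> (real \<Rightarrow> 'w \<Rightarrow> real^'n) \<Rightarrow> bool" where
  "markov_process M P F \<longleftrightarrow>
     (\<forall>x. prob_space (P x) \<and> sets (P x) = sets M) \<and>
     (\<forall>t\<ge>0. F t \<in> borel_measurable M) \<and>
     (\<forall>x. AE \<omega> in P x. F 0 \<omega> = x) \<and>
     (\<forall>t\<ge>0. \<forall>B\<in>sets borel.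
        (\<lambda>x. measure (P x) {\<omega> \<in> space M. F t \<omega> \<in> B}) \<in> borel_measurable borel) \<and>
     (\<forall>x. \<forall>s\<ge>0. \<forall>t\<ge>0. \<forall>B\<in>sets borel. AE \<omega> in P x.
        real_cond_exp (P x) (natural_filtration M F (ennreal s)) (\<lambda>\<omega>. indicator B (F (s + t) \<omega>)) \<omega>
          = measure (P (F s \<omega>)) {\<omega>' \<in> space M. F t \<omega>' \<in> B})"

text \<open>The Markov property at every (possibly infinite) stopping time, on the event that it is finite.\<close>

definition strong_markov ::
  "'w measure \<Rightarrow> (real^'n \<Rightarrow> 'w measure) \<Rightarrow> (real \<Rightarrow> 'w \<Rightarrow> real^'n) \<Rightarrow> bool" where
  "strong_markov M P F \<longleftrightarrow>
     (\<forall>\<tau>. stopping_time (natural_filtration M F) \<tau> \<longrightarrow>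
       (\<forall>x. \<forall>t\<ge>0. \<forall>B\<in>sets borel. AE \<omega> in P x. \<tau> \<omega> < \<infinity> \<longrightarrow>
          real_cond_exp (P x) (filtration.pre_sigma (space M) (natural_filtration M F) \<tau>)
            (\<lambda>\<omega>. indicator B (F (enn2real (\<tau> \<omega>) + t) \<omega>)) \<omega>
            = measure (P (F (enn2real (\<tau> \<omega>)) \<omega>)) {\<omega>' \<in> space M. F t \<omega>' \<in> B}))"

definition semigroup_op ::
  "(real^'n \<Rightarrow> 'w measure) \<Rightarrow> (real \<Rightarrow> 'w \<Rightarrow> real^'n) \<Rightarrow> real \<Rightarrow> (real^'n \<Rightarrow> real) \<Rightarrow> real^'n \<Rightarrow> real" where
  "semigroup_op P F t f x = (LINT \<omega>|P x. f (F t \<omega>))"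

definition feller_process ::
  "'w measure \<Rightarrow> (real^'n \<Rightarrow> 'w measure) \<Rightarrow> (real \<Rightarrow> 'w \<Rightarrow> real^'n) \<Rightarrow> bool" where
  "feller_process M P F \<longleftrightarrow>
     markov_process M P F \<and>
     (\<forall>t\<ge>0. \<forall>f\<in>C_infty. semigroup_op P F t f \<in> C_infty) \<and>
     (\<forall>f\<in>C_infty. uniform_limit UNIV (\<lambda>t. semigroup_op P F t f) f (at_right 0)) \<and>
     strong_markov M P F \<and>
     (\<forall>\<omega>\<in>space M. cadlag (\<lambda>t. F t \<omega>))"

definition has_generator ::
  "(real^'n \<Rightarrow> 'w measure) \<Rightarrow> (real \<Rightarrow> 'w \<Rightarrow> real^'n) \<Rightarrow> (real^'n \<Rightarrow> real) \<Rightarrow> (real^'n \<Rightarrow> real) \<Rightarrow> bool" where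
  "has_generator P F f g \<longleftrightarrow> f \<in> C_infty \<and> g \<in> C_infty \<and>
     uniform_limit UNIV (\<lambda>t x. (semigroup_op P F t f x - f x) / t) g (at_right 0)"

definition generator_domain ::
  "(real^'n \<Rightarrow> 'w measure) \<Rightarrow> (real \<Rightarrow> 'w \<Rightarrow> real^'n) \<Rightarrow> (real^'n \<Rightarrow> real) set" where
  "generator_domain P F = {f. \<exists>g. has_generator P F f g}"

definition generator ::
  "(real^'n \<Rightarrow> 'w measure) \<Rightarrow> (real \<Rightarrow> 'w \<Rightarrow> real^'n) \<Rightarrow> (real^'n \<Rightarrow> real) \<Rightarrow> real^'n \<Rightarrow> real" where
  "generator P F f = (THE g. has_generator P F f g)"

section \<open>The symbol\<close>

definition levy_kernel :: "(real^'n \<Rightarrow> (real^'n) measure) \<Rightarrow> bool" where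
  "levy_kernel \<nu> \<longleftrightarrow>
     (\<forall>x. sets (\<nu> x) = sets borel) \<and>
     (\<forall>B\<in>sets borel. (\<lambda>x. emeasure (\<nu> x) B) \<in> borel_measurable borel) \<and>
     (\<forall>x. emeasure (\<nu> x) {0} = 0) \<and>
     (\<forall>x. (\<integral>\<^sup>+y. ennreal (min 1 ((norm y)\<^sup>2)) \<partial>\<nu> x) < \<infinity>)"

definition levy_khintchine ::
  "real \<Rightarrow> real^'n \<Rightarrow> real^'n^'n \<Rightarrow> (real^'n) measure \<Rightarrow> real^'n \<Rightarrow> complex" where
  "levy_khintchine a b c \<nu> \<xi> =
     complex_of_real a - \<i> * complex_of_real (\<xi> \<bullet> b) + complex_of_real (1/2 * (\<xi> \<bullet> (c *v \<xi>)))
     - (LINT y|\<nu>. exp (\<i> * complex_of_real (\<xi> \<bullet> y)) - 1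
                    - \<i> * complex_of_real (\<xi> \<bullet> y) * indicator (cball 0 1) y)"

definition is_symbol ::
  "(real^'n \<Rightarrow> 'w measure) \<Rightarrow> (real \<Rightarrow> 'w \<Rightarrow> real^'n) \<Rightarrow> (real^'n \<Rightarrow> real^'n \<Rightarrow> complex) \<Rightarrow> bool" where
  "is_symbol P F q \<longleftrightarrow>
     (\<exists>a b c \<nu>. a \<in> borel_measurable borel \<and> (\<forall>x. 0 \<le> a x) \<and>
        b \<in> borel_measurable borel \<and>
        c \<in> borel_measurable borel \<and>
        (\<forall>x. transpose (c x) = c x \<and> (\<forall>\<xi>. 0 \<le> \<xi> \<bullet> (c x *v \<xi>))) \<and>
        levy_kernel \<nu> \<and>
        (\<forall>x \<xi>. q x \<xi> = levy_khintchine (a x) (b x) (c x) (\<nu> x) \<xi>)) \<and>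
     (\<forall>f\<in>Cc_infty. \<forall>x. complex_of_real (generator P F f x) =
        - (LINT \<xi>|lborel. q x \<xi> * exp (\<i> * complex_of_real (\<xi> \<bullet> x)) * fourier f \<xi>))"

section \<open>Irreducibility and nice Feller processes\<close>

definition irreducible_wrt ::
  "'w measure \<Rightarrow> (real^'n \<Rightarrow> 'w measure) \<Rightarrow> (real \<Rightarrow> 'w \<Rightarrow> real^'n) \<Rightarrow> (real^'n) measure \<Rightarrow> bool" where
  "irreducible_wrt M P F \<phi> \<longleftrightarrow>
     sigma_finite_measure \<phi> \<and> sets \<phi> = sets borel \<and>
     (\<forall>B\<in>sets borel. 0 < emeasure \<phi> B \<longrightarrow>
        (\<forall>x. 0 < (\<integral>\<^sup>+t\<in>{0..}. emeasure (P x) {\<omega> \<in> space M. F t \<omega> \<in> B} \<partial>lborel)))"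

text \<open>In the library, \<open>absolutely_continuous \<psi> \<phi>\<close> reads \<open>\<phi> \<lless> \<psi>\<close>.\<close>

definition maximal_irreducibility_measure ::
  "'w measure \<Rightarrow> (real^'n \<Rightarrow> 'w measure) \<Rightarrow> (real \<Rightarrow> 'w \<Rightarrow> real^'n) \<Rightarrow> (real^'n) measure \<Rightarrow> bool" where
  "maximal_irreducibility_measure M P F \<psi> \<longleftrightarrow>
     sigma_finite_measure \<psi> \<and> sets \<psi> = sets borel \<and>
     (\<forall>\<phi>. sigma_finite_measure \<phi> \<and> sets \<phi> = sets borel \<longrightarrow>
        (irreducible_wrt M P F \<phi> \<longleftrightarrow> absolutely_continuous \<psi> \<phi>))"

text \<open>
  The process is irreducible when a maximal irreducibility measure exists; as that measure is unique
  up to null sets and charges open sets here, the trivial \<open>\<phi> = 0\<close> needs no separate exclusion.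
\<close>

definition nice_feller_process ::
  "'w measure \<Rightarrow> (real^'n \<Rightarrow> 'w measure) \<Rightarrow> (real \<Rightarrow> 'w \<Rightarrow> real^'n) \<Rightarrow>
   (real^'n \<Rightarrow> real^'n \<Rightarrow> complex) \<Rightarrow> bool" where
  "nice_feller_process M P F q \<longleftrightarrow>
     feller_process M P F \<and>
     Cc_infty \<subseteq> generator_domain P F \<and>
     is_symbol P F q \<and>
     (\<exists>C\<ge>0. \<forall>\<xi> x. cmod (q x \<xi>) \<le> C * (1 + (norm \<xi>)\<^sup>2)) \<and>
     (\<forall>x. q x 0 = 0) \<and>
     (\<exists>\<psi>. maximal_irreducibility_measure M P F \<psi> \<and>
        (\<forall>U. open U \<and> U \<noteq> {} \<longrightarrow> 0 < emeasure \<psi> U))"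

section \<open>Pruitt indices\<close>

text \<open>
  For a nice Feller process the supremum below is over a bounded set and the infimum over a set
  of nonnegative reals, so the real-valued \<open>SUP\<close> and \<open>INF\<close> are the true ones.
\<close>

definition sup_symbol :: "(real^'n \<Rightarrow> real^'n \<Rightarrow> complex) \<Rightarrow> real^'n \<Rightarrow> real" where
  "sup_symbol q \<xi> = (SUP x. cmod (q x \<xi>))"

definition inf_Re_symbol :: "(real^'n \<Rightarrow> real^'n \<Rightarrow> complex) \<Rightarrow> real^'n \<Rightarrow> real" where
  "inf_Re_symbol q \<xi> = (INF x. Re (q x \<xi>))"

text \<open>The indices live in \<open>[0,\<infinity>]\<close>, where the supremum of the empty set is \<open>0\<close>.\<close>

definition pruitt_beta :: "(real^'n \<Rightarrow> real^'n \<Rightarrow> complex) \<Rightarrow> ennreal" where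
  "pruitt_beta q =
     Sup {ennreal \<alpha> | \<alpha>. 0 \<le> \<alpha> \<and> ((\<lambda>\<xi>. sup_symbol q \<xi> / norm \<xi> powr \<alpha>) \<longlongrightarrow> 0) (at 0)}"

definition pruitt_delta :: "(real^'n \<Rightarrow> real^'n \<Rightarrow> complex) \<Rightarrow> ennreal" where
  "pruitt_delta q =
     Sup {ennreal \<alpha> | \<alpha>. 0 \<le> \<alpha> \<and> ((\<lambda>\<xi>. inf_Re_symbol q \<xi> / norm \<xi> powr \<alpha>) \<longlongrightarrow> 0) (at 0)}"

definition radial_convex_near_0 :: "(real^'n \<Rightarrow> real) \<Rightarrow> bool" where
  "radial_convex_near_0 G \<longleftrightarrow>
     (\<exists>g. (\<forall>\<xi>. G \<xi> = g (norm \<xi>)) \<and> (\<exists>\<epsilon>>0. convex_on {0..<\<epsilon>} g))"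

definition radial_concave_near_0 :: "(real^'n \<Rightarrow> real) \<Rightarrow> bool" where
  "radial_concave_near_0 G \<longleftrightarrow>
     (\<exists>g. (\<forall>\<xi>. G \<xi> = g (norm \<xi>)) \<and> (\<exists>\<epsilon>>0. concave_on {0..<\<epsilon>} g))"

end

theory Submission
  imports Defs
begin

text \<open>
  With \<open>q(x, 0) = 0\<close>, convexity makes a profile \<open>g\<close> at most linear near \<open>0\<close>, which bounds an index from
  below by \<open>1\<close>. Concavity makes it at least linear unless it vanishes near \<open>0\<close>; this bounds the index by
  \<open>1\<close> and makes \<open>1 / g(\<bar>\<xi>\<bar>)\<close> integrable in dimension at least \<open>2\<close>. For the infimum of \<open>Re q\<close>, vanishing
  near \<open>0\<close> means \<open>\<delta> = \<infinity>\<close>. For the supremum of \<open>\<bar>q\<bar>\<close>, it forces \<open>q = 0\<close> everywhere by the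
  Levy-Khintchine formula, hence a generator that is zero on test functions; a bump function with a
  strict maximum at \<open>x\<close> then shows that the process never leaves \<open>x\<close>, against irreducibility.
\<close>

section \<open>Smooth bump functions\<close>

text \<open>\<open>flat 0\<close> is the classical smooth function exp(-1/t) extended by zero. The
  extra powers of 1/t are included because they make the family closed under differentiation up to
  linear combinations.\<close>

definition flat :: "nat \<Rightarrow> real \<Rightarrow> real" where
  "flat m t = (if t \<le> 0 then 0 else exp (- 1 / t) / t ^ m)"

lemma flat_at_right: "(flat m \<longlongrightarrow> 0) (at_right 0)"
proof -
  have "((\<lambda>t::real. inverse t ^ m / exp (inverse t)) \<longlongrightarrow> 0) (at_right 0)"
    using filterlim_compose[OF tendsto_power_div_exp_0 filterlim_inverse_at_top_right] .
  moreover have "\<forall>\<^sub>F t in at_right 0. inverse t ^ m / exp (inverse t) = flat m t"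
    by (rule eventually_at_rightI[of 0 1])
       (auto simp: flat_def field_simps exp_minus)
  ultimately show ?thesis
    by (rule Lim_transform_eventually)
qed

lemma flat_has_derivative:
  "(flat m has_real_derivative flat (m + 2) t - of_nat m * flat (m + 1) t) (at t)"
proof (cases t "0::real" rule: linorder_cases)
  case less
  have "((\<lambda>_. 0) has_real_derivative 0) (at t)"
    by simp
  then have "(flat m has_real_derivative 0) (at t)"
    by (rule has_field_derivative_transform_within_open[of _ _ _ "{..<0}"]) (use less in \<open>auto simp: flat_def\<close>)
  with less show ?thesis
    by (simp add: flat_def)
next
  case greater
  have pow: "t * t ^ (n - Suc 0) = t ^ n" if "n > 0" for n
    using that by (cases n) auto
  have "((\<lambda>t. exp (- 1 / t) / t ^ m) has_real_derivative
      exp (- 1 / t) / t ^ (m + 2) - of_nat m * (exp (- 1 / t) / t ^ (m + 1))) (at t)"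
    using greater
    by (cases m) (auto intro!: derivative_eq_intros simp: field_simps power2_eq_square, metis pow gr0I)
  then have "(flat m has_real_derivative
      exp (- 1 / t) / t ^ (m + 2) - of_nat m * (exp (- 1 / t) / t ^ (m + 1))) (at t)"
    by (rule has_field_derivative_transform_within_open[of _ _ _ "{0<..}"]) (use greater in \<open>auto simp: flat_def\<close>)
  with greater show ?thesis
    by (simp add: flat_def)
next
  case equal
  have "((\<lambda>h. flat m h / h) \<longlongrightarrow> 0) (at_left 0)"
    by (rule tendsto_eventually, rule eventually_at_leftI[of "-1"]) (auto simp: flat_def)
  \<comment> \<open>For positive h the difference quotient at the origin is itself a member of the
    family, namely \<open>flat (Suc m) h\<close>, so its limit is already known.\<close>
  moreover have "((\<lambda>h. flat m h / h) \<longlongrightarrow> 0) (at_right 0)"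
    by (rule Lim_transform_eventually[OF flat_at_right[of "Suc m"]],
        rule eventually_at_rightI[of 0 1]) (auto simp: flat_def)
  ultimately have "((\<lambda>h. flat m h / h) \<longlongrightarrow> 0) (at 0)"
    by (simp add: filterlim_split_at)
  then show ?thesis
    by (simp add: equal DERIV_def flat_def)
qed

text \<open>An algebra of functions that contains the bumps centred at \<open>z\<close> and is
  stable under directional derivatives. Smoothness of every order then follows by induction, without
  computing higher derivatives.\<close>

inductive bump_algebra :: "real^'n \<Rightarrow> (real^'n \<Rightarrow> real) \<Rightarrow> bool" for z where
  flat: "bump_algebra z (\<lambda>x. flat m (1 - (x - z) \<bullet> (x - z)))"
| inner: "bump_algebra z (\<lambda>x. (x - z) \<bullet> v)"
| const: "bump_algebra z (\<lambda>_. c)"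
| add: "bump_algebra z f \<Longrightarrow> bump_algebra z g \<Longrightarrow> bump_algebra z (\<lambda>x. f x + g x)"
| mult: "bump_algebra z f \<Longrightarrow> bump_algebra z g \<Longrightarrow> bump_algebra z (\<lambda>x. f x * g x)"

lemma bump_algebra_has_derivative:
  assumes "bump_algebra z f"
  shows "\<exists>D. (\<forall>x. (f has_derivative D x) (at x)) \<and> (\<forall>v. bump_algebra z (\<lambda>x. D x v))"
  using assms
proof induction
  case (flat m)
  \<comment> \<open>The chain rule, with the subtraction written as adding a multiple by
    \<open>- real m\<close> so that the rules \<open>add\<close>, \<open>mult\<close> and
    \<open>const\<close> apply literally.\<close>
  define D where "D x v = (flat (m + 2) (1 - (x - z) \<bullet> (x - z)) + (- real m) * flat (m + 1) (1 - (x - z) \<bullet> (x - z)))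
    * (- 2 * ((x - z) \<bullet> v))" for x v
  have "((\<lambda>x. flat m (1 - (x - z) \<bullet> (x - z))) has_derivative D x) (at x)" for x
  proof -
    have "((\<lambda>x. 1 - (x - z) \<bullet> (x - z)) has_derivative (\<lambda>v. - 2 * ((x - z) \<bullet> v))) (at x)"
      by (auto intro!: derivative_eq_intros simp: inner_commute)
    then show ?thesis
      by (rule has_derivative_eq_rhs[OF DERIV_compose_FDERIV[OF flat_has_derivative]])
         (auto simp: D_def fun_eq_iff)
  qed
  moreover have "bump_algebra z (\<lambda>x. D x v)" for v
    unfolding D_def by (intro bump_algebra.intros)
  ultimately show ?case by blast
next
  case (inner v)
  have "((\<lambda>x. (x - z) \<bullet> v) has_derivative (\<lambda>w. w \<bullet> v)) (at x)" for x
    by (auto intro!: derivative_eq_intros)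
  then show ?case
    by (intro exI[of _ "\<lambda>_ w. w \<bullet> v"]) (auto intro: bump_algebra.const)
next
  case (const c)
  show ?case
    by (intro exI[of _ "\<lambda>_ _. 0"]) (auto intro: bump_algebra.const)
next
  case (add f g)
  then obtain Df Dg where "\<And>x. (f has_derivative Df x) (at x)" "\<And>x. (g has_derivative Dg x) (at x)"
    and "\<And>v. bump_algebra z (\<lambda>x. Df x v)" "\<And>v. bump_algebra z (\<lambda>x. Dg x v)"
    by blast
  then show ?case
    by (intro exI[of _ "\<lambda>x v. Df x v + Dg x v"])
       (auto intro!: bump_algebra.add has_derivative_add)
next
  case (mult f g)
  then obtain Df Dg where "\<And>x. (f has_derivative Df x) (at x)" "\<And>x. (g has_derivative Dg x) (at x)"
    and "\<And>v. bump_algebra z (\<lambda>x. Df x v)" "\<And>v. bump_algebra z (\<lambda>x. Dg x v)"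
    by blast
  with mult.hyps show ?case
    by (intro exI[of _ "\<lambda>x v. f x * Dg x v + Df x v * g x"])
       (auto intro!: bump_algebra.add bump_algebra.mult has_derivative_mult)
qed

lemma bump_algebra_Ck: "bump_algebra z f \<Longrightarrow> Ck k f"
proof (induction k arbitrary: f)
  case 0
  then show ?case
    using bump_algebra_has_derivative[OF 0]
    by (auto intro!: continuous_at_imp_continuous_on dest: has_derivative_continuous)
next
  case (Suc k)
  obtain D where D: "\<And>x. (f has_derivative D x) (at x)" "\<And>v. bump_algebra z (\<lambda>x. D x v)"
    using bump_algebra_has_derivative[OF Suc.prems] by blast
  have "partial i f = (\<lambda>x. D x (axis i 1))" for i
    using frechet_derivative_at[OF D(1)] by (auto simp: partial_def fun_eq_iff)
  with D Suc.IH show ?case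
    by (auto simp: differentiable_def)
qed

text \<open>\<open>flat 0\<close> vanishes at nonpositive arguments, which confines the support to
  the closed unit ball around \<open>z\<close>.\<close>

lemma bump_in_Cc_infty: "(\<lambda>x. flat 0 (1 - (x - z) \<bullet> (x - z))) \<in> Cc_infty"
proof -
  have "{x. flat 0 (1 - (x - z) \<bullet> (x - z)) \<noteq> 0} \<subseteq> cball z 1"
  proof
    fix x assume "x \<in> {x. flat 0 (1 - (x - z) \<bullet> (x - z)) \<noteq> 0}"
    then have "(norm (x - z))\<^sup>2 \<le> 1\<^sup>2"
      by (auto simp: flat_def power2_norm_eq_inner split: if_splits)
    then have "norm (x - z) \<le> 1"
      by (rule power2_le_imp_le) simp
    then show "x \<in> cball z 1"
      by (simp add: dist_norm norm_minus_commute)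
  qed
  then have "closure {x. flat 0 (1 - (x - z) \<bullet> (x - z)) \<noteq> 0} \<subseteq> cball z 1"
    by (rule closure_minimal) simp
  then show ?thesis
    unfolding Cc_infty_def
    by (auto intro!: bump_algebra_Ck bump_algebra.flat compact_closure[THEN iffD2]
        bounded_subset[OF bounded_cball] dest: order_trans[OF closure_subset])
qed

text \<open>Strictness of the maximum at \<open>z\<close> is what later turns an equality of
  expectations into the almost sure statement that the process sits at \<open>z\<close>.\<close>

lemma bump_less:
  assumes "x \<noteq> z"
  shows "flat 0 (1 - (x - z) \<bullet> (x - z)) < flat 0 1"
proof -
  have "(x - z) \<bullet> (x - z) > 0"
    using assms by simp
  then show ?thesis
    by (auto simp: flat_def field_simps)
qed

section \<open>Growth near the origin of radial functions with a convex or concave profile\<close>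

text \<open>The point \<open>t\<close> is the convex combination of 0 and \<open>s\<close> with
  weight \<open>t / s\<close> on \<open>s\<close>, and the endpoint 0 contributes nothing. Applied
  to \<open>- g\<close>, the same bound serves concave profiles.\<close>

lemma convex_on_le_chord:
  assumes "convex_on {0..<\<epsilon>} g" "g 0 = (0::real)" "0 \<le> t" "t \<le> s" "0 < s" "s < \<epsilon>"
  shows "g t \<le> t / s * g s"
proof -
  have "g ((1 - t / s) *\<^sub>R 0 + (t / s) *\<^sub>R s) \<le> (1 - t / s) * g 0 + t / s * g s"
    by (rule convex_onD[OF assms(1)]) (use assms in auto)
  then show ?thesis
    using assms by simp
qed

text \<open>The chord bound makes \<open>G\<close> at most linear near the origin, so dividing by
  the power \<alpha> < 1 leaves a multiple of the positive power 1 - \<alpha> of the norm. The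
  function \<open>G\<close> is abstract so that one lemma serves both indices.\<close>

lemma radial_convex_index_ge_1:
  fixes G :: "real^'n \<Rightarrow> real"
  assumes "radial_convex_near_0 G" "G 0 = 0" "\<And>\<xi>. 0 \<le> G \<xi>"
  shows "1 \<le> Sup {ennreal \<alpha> | \<alpha>. 0 \<le> \<alpha> \<and> ((\<lambda>\<xi>. G \<xi> / norm \<xi> powr \<alpha>) \<longlongrightarrow> 0) (at 0)}"
    (is "1 \<le> Sup ?A")
\<comment> \<open>The exponent 1 itself need not be admissible, as a linear profile shows; it
  suffices that all smaller exponents are.\<close>
proof (rule dense_le)
  fix a :: ennreal assume "a < 1"
  then obtain \<alpha> where \<alpha>: "a = ennreal \<alpha>" "0 \<le> \<alpha>" "\<alpha> < 1"
    by (cases a) (auto simp: ennreal_less_one_iff)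
  obtain g \<epsilon> where g: "\<And>\<xi>. G \<xi> = g (norm \<xi>)" "\<epsilon> > 0" "convex_on {0..<\<epsilon>} g"
    using assms(1) by (auto simp: radial_convex_near_0_def)
  have g0: "g 0 = 0"
    using g(1)[of 0] assms(2) by simp
  define s where "s = \<epsilon> / 2"
  have s: "0 < s" "s < \<epsilon>"
    using g by (auto simp: s_def)
  have "((\<lambda>\<xi>. G \<xi> / norm \<xi> powr \<alpha>) \<longlongrightarrow> 0) (at 0)"
  proof (rule tendsto_sandwich)
    show "\<forall>\<^sub>F \<xi> in at 0. 0 \<le> G \<xi> / norm \<xi> powr \<alpha>"
      using assms(3) by simp
    show "\<forall>\<^sub>F \<xi> in at 0. G \<xi> / norm \<xi> powr \<alpha> \<le> g s / s * norm \<xi> powr (1 - \<alpha>)"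
    proof (rule eventually_at_ball'[where \<delta> = s and z = 0 and A = UNIV, THEN eventually_mono])
      fix \<xi> :: "real^'n" assume "\<xi> \<in> ball 0 s \<and> \<xi> \<noteq> 0 \<and> \<xi> \<in> UNIV"
      then have \<xi>: "norm \<xi> \<le> s" "norm \<xi> > 0"
        by auto
      then have "G \<xi> \<le> norm \<xi> / s * g s"
        using g g0 s convex_on_le_chord by simp
      then have "G \<xi> / norm \<xi> powr \<alpha> \<le> (norm \<xi> / s * g s) / norm \<xi> powr \<alpha>"
        by (rule divide_right_mono) simp
      also have "\<dots> = g s / s * norm \<xi> powr (1 - \<alpha>)"
        using \<xi> by (simp add: powr_diff)
      finally show "G \<xi> / norm \<xi> powr \<alpha> \<le> g s / s * norm \<xi> powr (1 - \<alpha>)" .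
    qed (use s in simp)
    show "((\<lambda>\<xi>::real^'n. g s / s * norm \<xi> powr (1 - \<alpha>)) \<longlongrightarrow> 0) (at 0)"
      using \<alpha> by (intro tendsto_mult_right_zero tendsto_zero_powrI[where b = "1 - \<alpha>"] tendsto_intros
          tendsto_norm_zero) auto
  qed simp
  then show "a \<le> Sup ?A"
    using \<alpha> by (intro Sup_upper) auto
qed

text \<open>A nonnegative profile that is nonzero at some radius \<open>s\<close> inside the
  interval of concavity is positive there, and concavity keeps it above the chord from the origin to
  that point.\<close>

lemma radial_concave_linear_lower_bound:
  fixes G :: "real^'n \<Rightarrow> real"
  assumes "radial_concave_near_0 G" "G 0 = 0" "\<And>\<xi>. 0 \<le> G \<xi>"
  shows "(\<forall>\<^sub>F \<xi> in nhds 0. G \<xi> = 0) \<or> (\<exists>c>0. \<exists>s>0. \<forall>\<xi>. norm \<xi> \<le> s \<longrightarrow> c * norm \<xi> \<le> G \<xi>)"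
proof -
  obtain g \<epsilon> where g: "\<And>\<xi>. G \<xi> = g (norm \<xi>)" "\<epsilon> > 0" "concave_on {0..<\<epsilon>} g"
    using assms(1) by (auto simp: radial_concave_near_0_def)
  have g0: "g 0 = 0"
    using g(1)[of 0] assms(2) by simp
  show ?thesis
  proof (cases "\<exists>\<xi>. norm \<xi> < \<epsilon> \<and> G \<xi> \<noteq> 0")
    case True
    then obtain \<xi>\<^sub>0 where \<xi>\<^sub>0: "norm \<xi>\<^sub>0 < \<epsilon>" "G \<xi>\<^sub>0 > 0"
      using assms(3) by (metis less_eq_real_def)
    define s where "s = norm \<xi>\<^sub>0"
    have s: "s > 0" "g s > 0" "s < \<epsilon>"
      using \<xi>\<^sub>0 assms(2) g(1) by (auto simp: s_def)
    have "g s / s * norm \<xi> \<le> G \<xi>" if "norm \<xi> \<le> s" for \<xi>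
      using convex_on_le_chord[of \<epsilon> "\<lambda>x. - g x" "norm \<xi>" s] g g0 s that
      by (simp add: concave_on_def mult.commute)
    with s have "\<exists>c>0. \<exists>s>0. \<forall>\<xi>. norm \<xi> \<le> s \<longrightarrow> c * norm \<xi> \<le> G \<xi>"
      by (intro exI[of _ "g s / s"] conjI exI[of _ s]) auto
    then show ?thesis ..
  next
    case False
    then show ?thesis
      using g(2) by (intro disjI1) (auto simp: eventually_nhds_metric)
  qed
qed

text \<open>For \<alpha> > 1 and norm at most 1, the power \<alpha> of the norm is at most the norm,
  so the quotient stays above \<open>c\<close> and cannot tend to 0.\<close>

lemma linear_lower_bound_index_le_1:
  fixes G :: "real^'n \<Rightarrow> real"
  assumes "c > 0" "s > 0" "\<And>\<xi>. norm \<xi> \<le> s \<Longrightarrow> c * norm \<xi> \<le> G \<xi>"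
  shows "Sup {ennreal \<alpha> | \<alpha>. 0 \<le> \<alpha> \<and> ((\<lambda>\<xi>. G \<xi> / norm \<xi> powr \<alpha>) \<longlongrightarrow> 0) (at 0)} \<le> 1"
proof (rule Sup_least, clarsimp)
  fix \<alpha> :: real
  assume "0 \<le> \<alpha>" and lim: "((\<lambda>\<xi>. G \<xi> / norm \<xi> powr \<alpha>) \<longlongrightarrow> 0) (at 0)"
  have False if "\<alpha> > 1"
  proof -
    have "\<forall>\<^sub>F \<xi> in at 0. c \<le> G \<xi> / norm \<xi> powr \<alpha>"
    proof (rule eventually_at_ball'[where \<delta> = "min 1 s" and z = 0 and A = UNIV, THEN eventually_mono])
      fix \<xi> :: "real^'n" assume "\<xi> \<in> ball 0 (min 1 s) \<and> \<xi> \<noteq> 0 \<and> \<xi> \<in> UNIV"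
      then have \<xi>: "norm \<xi> \<le> s" "norm \<xi> > 0" "norm \<xi> \<le> 1"
        by auto
      have "norm \<xi> powr \<alpha> \<le> norm \<xi> powr 1"
        using \<xi> that by (intro powr_mono') auto
      then have "c * norm \<xi> powr \<alpha> \<le> c * norm \<xi>"
        using \<open>c > 0\<close> by simp
      also have "\<dots> \<le> G \<xi>"
        by (rule assms) fact
      finally show "c \<le> G \<xi> / norm \<xi> powr \<alpha>"
        using \<xi> by (simp add: field_simps)
    qed (use assms in simp)
    from tendsto_lowerbound[OF lim this] \<open>c > 0\<close> show False
      by simp
  qed
  then show "\<alpha> \<le> 1"
    by force
qed

text \<open>Dyadic comparison: on the shell where the norm lies between 2^-(k+1) and 2^-k, the
  integrand is at most 2^(k+1), the value of \<open>h k\<close> on the whole ball of radius 2^-k. In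
  dimension at least 2 the integrals of the \<open>h k\<close> are dominated by a geometric
  series.\<close>

lemma nn_integral_inverse_norm_finite:
  assumes "DIM('a::euclidean_space) \<ge> 2"
  shows "(\<integral>\<^sup>+x\<in>ball (0::'a) 1. ennreal (1 / norm x) \<partial>lborel) < \<infinity>"
proof -
  let ?d = "DIM('a)"
  let ?V = "unit_ball_vol (real ?d)"
  have V: "?V \<ge> 0"
    by simp
  define h :: "nat \<Rightarrow> 'a \<Rightarrow> ennreal"
    where "h k x = ennreal (2 ^ (k + 1)) * indicator (ball 0 (1 / 2 ^ k)) x" for k x
  have le: "ennreal (1 / norm x) * indicator (ball 0 1) x
      \<le> (\<Sum>k. h k x)"
    for x
  proof (cases "x \<in> ball 0 1 \<and> x \<noteq> 0")
    case False
    \<comment> \<open>At the origin the real quotient \<open>1 / norm x\<close> is 0 by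
      convention.\<close>
    then have "ennreal (1 / norm x) * indicator (ball 0 1) x = 0"
      by (auto split: split_indicator)
    then show ?thesis
      by (metis zero_le)
  next
    case True
    have "\<exists>k. 1 / 2 ^ k \<le> norm x"
      using True real_arch_pow_inv[of "norm x" "1/2"] by (auto simp: power_divide intro: less_imp_le)
    \<comment> \<open>The least such \<open>k\<close> is not 0, since the norm is below 1; its
      predecessor \<open>j\<close> indexes the shell that contains \<open>x\<close>.\<close>
    then obtain k where k: "1 / 2 ^ k \<le> norm x" "\<And>j. j < k \<Longrightarrow> norm x < 1 / 2 ^ j"
      using exists_least_iff[of "\<lambda>k. 1 / 2 ^ k \<le> norm x"] by (auto simp: not_le)
    with True obtain j where j: "k = Suc j"
      by (cases k) auto
    have "1 / norm x \<le> 2 ^ (j + 1)"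
      using k(1) True by (simp add: j field_simps)
    then have "ennreal (1 / norm x) * indicator (ball 0 1) x \<le> h j x"
      using True k(2)[of j] by (simp add: j h_def ennreal_leI)
    also have "\<dots> \<le> (\<Sum>k. h k x)"
      using sum_le_suminf[of "\<lambda>k. h k x" "{j}"] by simp
    finally show ?thesis .
  qed
  have "(\<integral>\<^sup>+x\<in>ball (0::'a) 1. ennreal (1 / norm x) \<partial>lborel)
      \<le> (\<integral>\<^sup>+x. (\<Sum>k. h k x) \<partial>lborel)"
    by (intro nn_integral_mono le)
  also have "\<dots> = (\<Sum>k. \<integral>\<^sup>+x. h k x \<partial>lborel)"
    by (rule nn_integral_suminf)
       (auto simp: h_def intro!: borel_measurable_times_ennreal borel_measurable_indicator)
  also have "\<dots> \<le> (\<Sum>k. ennreal (2 * ?V * (1 / 2) ^ k))"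
  proof (rule suminf_le)
    fix k
    \<comment> \<open>The dimension enters here: the volume decays at least like 4^-k, which beats
      the height 2^(k+1).\<close>
    have "((1::real) / 2 ^ k) ^ ?d \<le> (1 / 2 ^ k) ^ 2"
      using assms by (intro power_decreasing) auto
    then have "2 ^ (k + 1) * (?V * (1 / 2 ^ k) ^ ?d) \<le> 2 ^ (k + 1) * (?V * (1 / 2 ^ k) ^ 2)"
      using V by (intro mult_left_mono) auto
    also have "\<dots> = 2 * ?V * (1 / 2) ^ k"
      by (simp add: field_simps power2_eq_square)
    finally have le: "2 ^ (k + 1) * (?V * (1 / 2 ^ k) ^ ?d) \<le> 2 * ?V * (1 / 2) ^ k" .
    have "(\<integral>\<^sup>+x. h k x \<partial>lborel) = ennreal (2 ^ (k + 1)) * ennreal (?V * (1 / 2 ^ k) ^ ?d)"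
      unfolding h_def by (subst nn_integral_cmult_indicator) (simp_all only: emeasure_ball sets_lborel open_ball borel_open zero_le_divide_1_iff zero_le_power zero_le_numeral)
    also have "\<dots> = ennreal (2 ^ (k + 1) * (?V * (1 / 2 ^ k) ^ ?d))"
      by (rule ennreal_mult'[symmetric]) simp
    also have "\<dots> \<le> ennreal (2 * ?V * (1 / 2) ^ k)"
      by (rule ennreal_leI[OF le])
    finally show "(\<integral>\<^sup>+x. h k x \<partial>lborel) \<le> ennreal (2 * ?V * (1 / 2) ^ k)" .
  qed (rule summableI)+
  also have "\<dots> = ennreal (\<Sum>k. 2 * ?V * (1 / 2) ^ k)"
    using V by (intro suminf_ennreal2) (auto intro!: summable_mult summable_geometric)
  also have "\<dots> < \<infinity>"
    by simp
  finally show ?thesis .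
qed

lemma linear_lower_bound_nn_integral_finite:
  fixes G :: "real^'n \<Rightarrow> real"
  assumes "c > 0" "s > 0" "\<And>\<xi>. norm \<xi> \<le> s \<Longrightarrow> c * norm \<xi> \<le> G \<xi>" "CARD('n) \<ge> 2"
  shows "\<exists>r>0. (\<integral>\<^sup>+\<xi>\<in>ball 0 r. 1 / ennreal (G \<xi>) \<partial>lborel) < \<infinity>"
proof (intro exI conjI)
  show "min 1 s > 0"
    using assms by simp
  \<comment> \<open>The comparison holds only almost everywhere: at the origin the left side may be
    infinite, while the real quotient on the right is 0.\<close>
  have "AE \<xi> in lborel. 1 / ennreal (G \<xi>) * indicator (ball 0 (min 1 s)) \<xi>
      \<le> ennreal (1 / c) * (ennreal (1 / norm \<xi>) * indicator (ball (0::real^'n) 1) \<xi>)"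
    using AE_lborel_singleton[of "0::real^'n"]
  proof eventually_elim
    case (elim \<xi>)
    show ?case
    proof (cases "\<xi> \<in> ball 0 (min 1 s)")
      case True
      then have \<xi>: "norm \<xi> \<le> s" "norm \<xi> > 0"
        using elim by auto
      with assms(3) have le: "c * norm \<xi> \<le> G \<xi>" by simp
      moreover have "c * norm \<xi> > 0" using \<xi> assms by simp
      ultimately have "G \<xi> > 0" by linarith
      then have "1 / ennreal (G \<xi>) = ennreal (1 / G \<xi>)"
        by (simp add: divide_ennreal flip: ennreal_1)
      also have "\<dots> \<le> ennreal (1 / (c * norm \<xi>))"
        using le \<open>c * norm \<xi> > 0\<close> by (intro ennreal_leI divide_left_mono) auto
      also have "\<dots> = ennreal (1 / c) * ennreal (1 / norm \<xi>)"
        using \<open>c > 0\<close> by (simp flip: ennreal_mult')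
      finally show ?thesis
        using True by simp
    qed simp
  qed
  then have "(\<integral>\<^sup>+\<xi>\<in>ball 0 (min 1 s). 1 / ennreal (G \<xi>) \<partial>lborel)
      \<le> (\<integral>\<^sup>+\<xi>. ennreal (1 / c) * (ennreal (1 / norm \<xi>) * indicator (ball (0::real^'n) 1) \<xi>) \<partial>lborel)"
    by (rule nn_integral_mono_AE)
  also have "\<dots> = ennreal (1 / c) * (\<integral>\<^sup>+\<xi>\<in>ball (0::real^'n) 1. ennreal (1 / norm \<xi>) \<partial>lborel)"
    by (rule nn_integral_cmult) (auto intro!: borel_measurable_times_ennreal borel_measurable_indicator)
  also have "\<dots> < \<infinity>"
    using nn_integral_inverse_norm_finite[where 'a = "real^'n"] assms(4)
    by (simp add: ennreal_mult_less_top)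
  finally show "(\<integral>\<^sup>+\<xi>\<in>ball 0 (min 1 s). 1 / ennreal (G \<xi>) \<partial>lborel) < \<infinity>" .
qed

text \<open>The quotient is eventually 0 for every exponent, so the set of admissible exponents is
  unbounded.\<close>

lemma eventually_zero_index_infinite:
  fixes G :: "real^'n \<Rightarrow> real"
  assumes "\<forall>\<^sub>F \<xi> in nhds 0. G \<xi> = 0"
  shows "Sup {ennreal \<alpha> | \<alpha>. 0 \<le> \<alpha> \<and> ((\<lambda>\<xi>. G \<xi> / norm \<xi> powr \<alpha>) \<longlongrightarrow> 0) (at 0)} = \<infinity>" (is "Sup ?A = _")
proof -
  have "((\<lambda>\<xi>. G \<xi> / norm \<xi> powr \<alpha>) \<longlongrightarrow> 0) (at 0)" for \<alpha>
    using assms by (intro tendsto_eventually) (auto simp: eventually_at_filter elim: eventually_mono)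
  then have "ennreal (real n) \<le> Sup ?A" for n :: nat
    by (intro Sup_upper) auto
  then have "of_nat n \<le> Sup ?A" for n :: nat
    by (simp add: ennreal_of_nat_eq_real_of_nat)
  moreover have "x = \<infinity>" if "\<And>n::nat. of_nat n \<le> x" for x :: ennreal
    using that ennreal_Ex_less_of_nat[of x] by (metis infinity_ennreal_def not_le top.not_eq_extremum)
  ultimately show ?thesis
    by blast
qed

section \<open>The Levy--Khintchine formula\<close>

text \<open>Inside the unit ball the second-order Taylor remainder is at most the square of the
  inner product over 2; outside it the compensator is absent and the integrand is at most 2. The
  constant in the dominating function covers both cases.\<close>

lemma levy_khintchine_integrable:
  fixes \<nu> :: "(real^'n) measure"
  assumes \<nu>[measurable_cong]: "sets \<nu> = sets borel"
    and fin: "(\<integral>\<^sup>+y. ennreal (min 1 ((norm y)\<^sup>2)) \<partial>\<nu>) < \<infinity>"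
  shows "integrable \<nu> (\<lambda>y. exp (\<i> * complex_of_real (\<xi> \<bullet> y)) - 1
    - \<i> * complex_of_real (\<xi> \<bullet> y) * indicator (cball 0 1) y)" (is "integrable \<nu> ?k")
proof (rule Bochner_Integration.integrable_bound)
  show "integrable \<nu> (\<lambda>y. (2 + (norm \<xi>)\<^sup>2) * min 1 ((norm y)\<^sup>2))"
    using fin by (intro integrable_mult_right integrableI_nonneg) auto
  show "?k \<in> borel_measurable \<nu>"
    by (auto intro!: borel_measurable_diff borel_measurable_times borel_measurable_indicator
        simp: measurable_cong_sets[OF \<nu> refl])
  show "AE y in \<nu>. norm (?k y) \<le> norm ((2 + (norm \<xi>)\<^sup>2) * min 1 ((norm y)\<^sup>2))"
  proof (rule AE_I2)
    fix y
    have "norm (?k y) \<le> (2 + (norm \<xi>)\<^sup>2) * min 1 ((norm y)\<^sup>2)"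
    proof (cases "norm y \<le> 1")
      case True
      have "norm (?k y) \<le> \<bar>\<xi> \<bullet> y\<bar>\<^sup>2 / 2"
        using True iexp_approx1[of "\<xi> \<bullet> y" 1] by (simp add: numeral_2_eq_2 algebra_simps)
      also have "\<dots> \<le> (norm \<xi> * norm y)\<^sup>2 / 2"
        by (intro divide_right_mono power_mono Cauchy_Schwarz_ineq2) auto
      also have "\<dots> \<le> (2 + (norm \<xi>)\<^sup>2) * (norm y)\<^sup>2"
        by (simp add: power_mult_distrib algebra_simps)
      also have "(norm y)\<^sup>2 = min 1 ((norm y)\<^sup>2)"
        using True by (simp add: power_le_one)
      finally show ?thesis .
    next
      case False
      then have "norm (?k y) \<le> 2"
        using norm_triangle_ineq4[of "exp (\<i> * complex_of_real (\<xi> \<bullet> y))" 1] by simp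
      also have "2 \<le> (2 + (norm \<xi>)\<^sup>2) * min 1 ((norm y)\<^sup>2)"
        using False by (simp add: one_le_power min_absorb1)
      finally show ?thesis .
    qed
    then show "norm (?k y) \<le> norm ((2 + (norm \<xi>)\<^sup>2) * min 1 ((norm y)\<^sup>2))"
      by simp
  qed
qed

text \<open>Drift and compensator are purely imaginary. For admissible \<open>a\<close> and
  \<open>c\<close> the real part is thus a sum of three nonnegative terms, which must all vanish
  when it does.\<close>

lemma Re_levy_khintchine:
  fixes \<nu> :: "(real^'n) measure"
  assumes "sets \<nu> = sets borel" "(\<integral>\<^sup>+y. ennreal (min 1 ((norm y)\<^sup>2)) \<partial>\<nu>) < \<infinity>"
  shows "integrable \<nu> (\<lambda>y. 1 - cos (\<xi> \<bullet> y))"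
    and "Re (levy_khintchine a b c \<nu> \<xi>) = a + \<xi> \<bullet> (c *v \<xi>) / 2 + (LINT y|\<nu>. 1 - cos (\<xi> \<bullet> y))"
proof -
  note int = levy_khintchine_integrable[OF assms, of \<xi>]
  have Re: "Re (exp (\<i> * complex_of_real (\<xi> \<bullet> y)) - 1
      - \<i> * complex_of_real (\<xi> \<bullet> y) * indicator (cball 0 1) y) = cos (\<xi> \<bullet> y) - 1" for y
    by (simp add: Re_exp indicator_def)
  from integrable_Re[OF int] have "integrable \<nu> (\<lambda>y. cos (\<xi> \<bullet> y) - 1)"
    by (simp only: Re)
  from Bochner_Integration.integrable_minus[OF this]
  show "integrable \<nu> (\<lambda>y. 1 - cos (\<xi> \<bullet> y))"
    by simp
  have neg: "(LINT y|\<nu>. cos (\<xi> \<bullet> y) - 1) = - (LINT y|\<nu>. 1 - cos (\<xi> \<bullet> y))"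
    by (subst Bochner_Integration.integral_minus[symmetric]) simp
  from integral_Re[OF int]
  have "Re (LINT y|\<nu>. exp (\<i> * complex_of_real (\<xi> \<bullet> y)) - 1
      - \<i> * complex_of_real (\<xi> \<bullet> y) * indicator (cball 0 1) y) = - (LINT y|\<nu>. 1 - cos (\<xi> \<bullet> y))"
    by (simp only: Re neg)
  then show "Re (levy_khintchine a b c \<nu> \<xi>) = a + \<xi> \<bullet> (c *v \<xi>) / 2 + (LINT y|\<nu>. 1 - cos (\<xi> \<bullet> y))"
    by (simp add: levy_khintchine_def)
qed

lemma Re_levy_khintchine_nonneg:
  fixes \<nu> :: "(real^'n) measure"
  assumes "sets \<nu> = sets borel" "(\<integral>\<^sup>+y. ennreal (min 1 ((norm y)\<^sup>2)) \<partial>\<nu>) < \<infinity>"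
    and "0 \<le> a" "\<And>\<xi>. 0 \<le> \<xi> \<bullet> (c *v \<xi>)"
  shows "0 \<le> Re (levy_khintchine a b c \<nu> \<xi>)"
  unfolding Re_levy_khintchine(2)[OF assms(1,2)]
  using assms(3,4) by (intro add_nonneg_nonneg Bochner_Integration.integral_nonneg) auto

text \<open>A nonzero coordinate of \<open>y\<close> would, for large \<open>n\<close>, give a
  nonzero angle of modulus below 1, where the cosine is strictly less than 1. Only countably many
  frequencies are tested, so that the exceptional null sets can be united.\<close>

lemma cos_inner_eq_1_imp_0:
  fixes y :: "real^'n"
  assumes "\<epsilon> > 0" "\<And>i n. cos ((\<epsilon> / real (Suc n)) *\<^sub>R axis i 1 \<bullet> y) = 1"
  shows "y = 0"
proof (rule ccontr)
  assume "y \<noteq> 0"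
  then obtain i where i: "y $ i \<noteq> 0"
    by (auto simp: vec_eq_iff)
  obtain n where n: "\<epsilon> * \<bar>y $ i\<bar> < real (Suc n)"
    using reals_Archimedean2 less_trans by (metis lessI of_nat_less_iff)
  define \<theta> where "\<theta> = \<epsilon> / real (Suc n) * y $ i"
  have "cos \<theta> = 1"
    using assms(2)[of n i] by (simp add: \<theta>_def inner_axis')
  then have "cos \<bar>\<theta>\<bar> = 1"
    by simp
  moreover have "\<bar>\<theta>\<bar> < 1" "\<bar>\<theta>\<bar> > 0"
    using n i assms(1) by (auto simp: \<theta>_def abs_mult field_simps)
  ultimately show False
    using cos_monotone_0_pi[of 0 "\<bar>\<theta>\<bar>"] pi_gt3 by simp
qed

text \<open>Vanishing of the real part near the origin kills the killing rate and the diffusion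
  there and leaves the jump measure no mass away from 0. What remains is homogeneous in
  \<open>\<xi>\<close>, so its vanishing extends from small frequencies to all by scaling.\<close>

lemma levy_khintchine_eq_0:
  fixes \<nu> :: "(real^'n) measure"
  assumes \<nu>: "sets \<nu> = sets borel" "(\<integral>\<^sup>+y. ennreal (min 1 ((norm y)\<^sup>2)) \<partial>\<nu>) < \<infinity>"
    and a: "0 \<le> a" and c: "\<And>\<xi>. 0 \<le> \<xi> \<bullet> (c *v \<xi>)"
    and "\<epsilon> > 0" and zero: "\<And>\<xi>. norm \<xi> < \<epsilon> \<Longrightarrow> levy_khintchine a b c \<nu> \<xi> = 0"
  shows "levy_khintchine a b c \<nu> \<xi> = 0"
proof -
  have parts: "a = 0" "\<xi> \<bullet> (c *v \<xi>) = 0" "AE y in \<nu>. cos (\<xi> \<bullet> y) = 1" if "norm \<xi> < \<epsilon>" for \<xi>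
  proof -
    have pos: "0 \<le> (LINT y|\<nu>. 1 - cos (\<xi> \<bullet> y))"
      by (rule Bochner_Integration.integral_nonneg) simp
    have sum: "a + \<xi> \<bullet> (c *v \<xi>) / 2 + (LINT y|\<nu>. 1 - cos (\<xi> \<bullet> y)) = 0"
      using Re_levy_khintchine(2)[OF \<nu>, of a b c \<xi>] zero[OF that] by simp
    from sum pos a c[of \<xi>] show "a = 0" "\<xi> \<bullet> (c *v \<xi>) = 0"
      by linarith+
    from sum pos a c[of \<xi>] have "(LINT y|\<nu>. 1 - cos (\<xi> \<bullet> y)) = 0"
      by linarith
    then have "AE y in \<nu>. 1 - cos (\<xi> \<bullet> y) = 0"
      by (subst (asm) integral_nonneg_eq_0_iff_AE[OF Re_levy_khintchine(1)[OF \<nu>]]) auto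
    then show "AE y in \<nu>. cos (\<xi> \<bullet> y) = 1"
      by simp
  qed
  \<comment> \<open>Halving \<epsilon> keeps the largest frequency, at n = 0, strictly inside the
    ball.\<close>
  have "AE y in \<nu>. \<forall>i n. cos ((\<epsilon> / 2 / real (Suc n)) *\<^sub>R axis i 1 \<bullet> y) = 1"
  proof (intro AE_all_countable[THEN iffD2] allI parts)
    fix i :: 'n and n
    have "\<epsilon> / 2 / real (Suc n) \<le> \<epsilon> / 2"
      using \<open>\<epsilon> > 0\<close> by (simp add: field_simps)
    also have "\<dots> < \<epsilon>"
      using \<open>\<epsilon> > 0\<close> by simp
    finally show "norm ((\<epsilon> / 2 / real (Suc n)) *\<^sub>R (axis i 1 :: real^'n)) < \<epsilon>"
      using \<open>\<epsilon> > 0\<close> by (simp add: norm_axis_1 del: of_nat_Suc)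
  qed
  then have AE0: "AE y in \<nu>. y = 0"
    by (rule AE_mp) (rule AE_I2, use cos_inner_eq_1_imp_0[of "\<epsilon> / 2"] \<open>\<epsilon> > 0\<close> in auto)
  have drift: "levy_khintchine a b c \<nu> \<xi> = complex_of_real a - \<i> * complex_of_real (\<xi> \<bullet> b)
      + complex_of_real (1/2 * (\<xi> \<bullet> (c *v \<xi>)))" for \<xi>
  proof -
    have "(LINT y|\<nu>. exp (\<i> * complex_of_real (\<xi> \<bullet> y)) - 1
        - \<i> * complex_of_real (\<xi> \<bullet> y) * indicator (cball 0 1) y) = 0"
      by (rule integral_eq_zero_AE) (use AE0 in eventually_elim, simp)
    then show ?thesis
      by (simp add: levy_khintchine_def)
  qed
  \<comment> \<open>A positive scaling factor that brings \<open>\<xi>\<close> into the ball; adding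
    1 in the denominator covers \<open>\<xi>\<close> = 0.\<close>
  define u where "u = \<epsilon> / (2 * (1 + norm \<xi>))"
  have pos: "1 + norm \<xi> > 0"
    by (simp add: add_pos_nonneg)
  have u: "u > 0"
    using \<open>\<epsilon> > 0\<close> pos by (simp add: u_def)
  have "u * norm \<xi> < \<epsilon>"
    using \<open>\<epsilon> > 0\<close> pos by (simp add: u_def field_simps add_nonneg_pos)
  then have small: "norm (u *\<^sub>R \<xi>) < \<epsilon>"
    using u by simp
  have "\<xi> \<bullet> b = 0"
    using arg_cong[OF zero[OF small], of Im] u by (simp add: drift)
  moreover have "\<xi> \<bullet> (c *v \<xi>) = 0"
    using parts(2)[OF small] u by (simp add: matrix_vector_mult_scaleR)
  ultimately show ?thesis
    unfolding drift by (simp add: parts(1)[OF small])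
qed

section \<open>The transition semigroup\<close>

text \<open>The law of \<open>F t\<close> is moved to the state space, so that it becomes a Markov
  kernel there and kernels can be composed with the monadic bind.\<close>

definition transition ::
  "(real^'n \<Rightarrow> 'w measure) \<Rightarrow> (real \<Rightarrow> 'w \<Rightarrow> real^'n) \<Rightarrow> real \<Rightarrow> real^'n \<Rightarrow> (real^'n) measure" where
  "transition P F t x = distr (P x) borel (F t)"

lemma markov_processD:
  assumes "markov_process M P F"
  shows "prob_space (P x)" "sets (P x) = sets M" "space (P x) = space M"
    "0 \<le> t \<Longrightarrow> F t \<in> borel_measurable (P x)" "AE \<omega> in P x. F 0 \<omega> = x"
proof -
  have P: "prob_space (P x) \<and> sets (P x) = sets M" "\<And>t. 0 \<le> t \<Longrightarrow> F t \<in> borel_measurable M"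
    "AE \<omega> in P x. F 0 \<omega> = x"
    using assms unfolding markov_process_def by blast+
  then show "prob_space (P x)" "sets (P x) = sets M" "AE \<omega> in P x. F 0 \<omega> = x"
    by blast+
  then show "space (P x) = space M"
    by (intro sets_eq_imp_space_eq)
  show "F t \<in> borel_measurable (P x)" if "0 \<le> t"
    using P that by (simp cong: measurable_cong_sets)
qed

lemma measure_transition:
  assumes "markov_process M P F" "0 \<le> t" "B \<in> sets borel"
  shows "measure (transition P F t x) B = measure (P x) {\<omega> \<in> space M. F t \<omega> \<in> B}"
  using assms markov_processD[OF assms(1), where x = x]
  by (auto simp: transition_def measure_distr vimage_def intro!: arg_cong[where f = "measure (P x)"])

lemma prob_space_transition:
  assumes "markov_process M P F" "0 \<le> t"
  shows "prob_space (transition P F t x)"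
  unfolding transition_def
  using markov_processD[OF assms(1)] assms(2) by (intro prob_space.prob_space_distr) auto

lemma sets_transition [simp, measurable_cong]: "sets (transition P F t x) = sets borel"
  by (simp add: transition_def)

lemma measurable_transition:
  fixes P :: "real^'n \<Rightarrow> 'w measure"
  assumes "markov_process M P F" "0 \<le> t"
  shows "transition P F t \<in> borel \<rightarrow>\<^sub>M subprob_algebra borel"
proof (rule measurable_subprob_algebra)
  show "subprob_space (transition P F t x)" for x
    using prob_space_transition[OF assms] by (rule prob_space_imp_subprob_space)
  show "sets (transition P F t x) = sets borel" for x
    by simp
  fix B :: "(real^'n) set" assume B: "B \<in> sets borel"
  have "emeasure (transition P F t x) B = ennreal (measure (P x) {\<omega> \<in> space M. F t \<omega> \<in> B})" for x
    using prob_space.finite_measure[OF prob_space_transition[OF assms]]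
    by (simp add: finite_measure.emeasure_eq_measure measure_transition[OF assms B])
  then show "(\<lambda>x. emeasure (transition P F t x) B) \<in> borel_measurable borel"
    using assms B by (simp add: markov_process_def)
qed

lemma semigroup_op_transition:
  assumes "markov_process M P F" "0 \<le> t" "f \<in> borel_measurable borel"
  shows "semigroup_op P F t f x = (LINT y|transition P F t x. f y)"
  unfolding semigroup_op_def transition_def
  using markov_processD(4)[OF assms(1,2)] assms(3) by (subst integral_distr) auto

lemma subalgebra_natural_filtration:
  assumes "markov_process M P F"
  shows "subalgebra (P x) (natural_filtration M F s)"
proof -
  let ?G = "{F u -` B \<inter> space M | u B. 0 \<le> u \<and> ennreal u \<le> s \<and> B \<in> sets borel}"
  have "?G \<subseteq> sets M"
    using assms by (auto simp: markov_process_def intro: measurable_sets)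
  then have "sigma_sets (space M) ?G \<subseteq> sets M"
    by (rule sets.sigma_sets_subset)
  moreover have "?G \<subseteq> Pow (space M)"
    by auto
  ultimately show ?thesis
    unfolding subalgebra_def natural_filtration_def
    using markov_processD[OF assms, where x = x] by (simp add: space_measure_of sets_measure_of)
qed

text \<open>Taking expectations in the Markov property at time \<open>s\<close> removes the
  conditional expectation; the remaining function of \<open>F s\<close> is integrated against the
  law of \<open>F s\<close>.\<close>

lemma chapman_kolmogorov:
  assumes P: "markov_process M P F" and "0 \<le> s" "0 \<le> t"
  shows "transition P F (s + t) x = transition P F s x \<bind> transition P F t"
proof (rule measure_eqI)
  note [measurable] = measurable_transition[OF P]
  interpret Px: prob_space "P x"
    using markov_processD(1)[OF P] by simp
  interpret S: prob_space "transition P F s x"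
    using prob_space_transition[OF P \<open>0 \<le> s\<close>] .
  have ne: "space (transition P F s x) \<noteq> {}"
    by (rule S.not_empty)
  have kernel: "transition P F t \<in> transition P F s x \<rightarrow>\<^sub>M subprob_algebra borel"
    using measurable_transition[OF P \<open>0 \<le> t\<close>] by (simp cong: measurable_cong_sets)
  show "sets (transition P F (s + t) x) = sets (transition P F s x \<bind> transition P F t)"
    using sets_bind[OF sets_kernel[OF kernel] ne] by simp
  fix B assume "B \<in> sets (transition P F (s + t) x)"
  then have B[measurable]: "B \<in> sets borel" by simp
  let ?N = "natural_filtration M F (ennreal s)"
  interpret finite_measure_subalgebra "P x" ?N
    by unfold_locales (rule subalgebra_natural_filtration[OF P])
  have meas: "F (s + t) \<in> borel_measurable (P x)" "F s \<in> borel_measurable (P x)"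
    using markov_processD(4)[OF P] assms by auto
  have int: "integrable (P x) (\<lambda>\<omega>. indicator B (F (s + t) \<omega>) :: real)"
    using meas by (intro Px.integrable_const_bound[where B = 1]) (auto simp: indicator_def)
  have m[measurable]: "(\<lambda>y. measure (transition P F t y) B) \<in> borel_measurable borel"
    using P assms B by (simp add: markov_process_def measure_transition[OF P])
  have "measure (transition P F (s + t) x) B = (LINT y|transition P F (s + t) x. indicator B y)"
    by simp
  also have "\<dots> = (LINT \<omega>|P x. indicator B (F (s + t) \<omega>))"
    unfolding transition_def using meas by (subst integral_distr) auto
  also have "\<dots> = (LINT \<omega>|P x. real_cond_exp (P x) ?N (\<lambda>\<omega>. indicator B (F (s + t) \<omega>)) \<omega>)"
    by (rule real_cond_exp_int(2)[OF int, symmetric])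
  also have "\<dots> = (LINT \<omega>|P x. measure (transition P F t (F s \<omega>)) B)"
  proof (rule integral_cong_AE)
    show "AE \<omega> in P x. real_cond_exp (P x) ?N (\<lambda>\<omega>. indicator B (F (s + t) \<omega>)) \<omega>
        = measure (transition P F t (F s \<omega>)) B"
      using P assms B by (simp add: markov_process_def measure_transition[OF P])
    show "(\<lambda>\<omega>. measure (transition P F t (F s \<omega>)) B) \<in> borel_measurable (P x)"
      by (rule measurable_compose[OF meas(2) m])
  qed simp
  also have "\<dots> = (LINT y|transition P F s x. measure (transition P F t y) B)"
    unfolding transition_def[of P F s] using meas m by (subst integral_distr) auto
  finally have eq: "measure (transition P F (s + t) x) B
    = (LINT y|transition P F s x. measure (transition P F t y) B)" .
  \<comment> \<open>The bind is computed by a nonnegative integral, which agrees with the Bochner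
    integral above because probabilities are bounded by 1.\<close>
  have "emeasure (transition P F s x \<bind> transition P F t) B
      = (\<integral>\<^sup>+y. emeasure (transition P F t y) B \<partial>transition P F s x)"
    by (rule emeasure_bind[OF ne kernel B])
  also have "\<dots> = (\<integral>\<^sup>+y. ennreal (measure (transition P F t y) B) \<partial>transition P F s x)"
    using prob_space.finite_measure[OF prob_space_transition[OF P \<open>0 \<le> t\<close>]]
    by (simp add: finite_measure.emeasure_eq_measure)
  also have "\<dots> = ennreal (LINT y|transition P F s x. measure (transition P F t y) B)"
    using prob_space.prob_le_1[OF prob_space_transition[OF P \<open>0 \<le> t\<close>]]
    by (intro nn_integral_eq_integral S.integrable_const_bound[where B = 1]) auto
  also have "\<dots> = emeasure (transition P F (s + t) x) B"
    using prob_space.finite_measure[OF prob_space_transition[OF P, of "s + t"]] assms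
    by (simp add: finite_measure.emeasure_eq_measure eq)
  finally show "emeasure (transition P F (s + t) x) B
    = emeasure (transition P F s x \<bind> transition P F t) B" by simp
qed

text \<open>By the semigroup property the increment is the operator at time \<open>s\<close> applied
  to the increment over [0,t], and averaging against a probability measure does not enlarge a
  uniform bound.\<close>

lemma semigroup_op_increment:
  assumes P: "markov_process M P F" and st: "0 \<le> s" "0 \<le> t"
    and f: "f \<in> borel_measurable borel" "\<And>x. \<bar>f x\<bar> \<le> K"
    and e: "\<And>x. \<bar>semigroup_op P F t f x - f x\<bar> \<le> e"
  shows "\<bar>semigroup_op P F (s + t) f x - semigroup_op P F s f x\<bar> \<le> e"
proof -
  interpret S: prob_space "transition P F s x"
    using prob_space_transition[OF P st(1)] .
  let ?T = "\<lambda>y. LINT z|transition P F t y. f z"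
  have kernel: "transition P F t \<in> transition P F s x \<rightarrow>\<^sub>M subprob_algebra borel"
    using measurable_transition[OF P st(2)] by (simp cong: measurable_cong_sets)
  have prob: "prob_space (transition P F t y)" for y
    by (rule prob_space_transition[OF P st(2)])
  have eq: "semigroup_op P F (s + t) f x = (LINT y|transition P F s x. ?T y)"
    unfolding semigroup_op_transition[OF P add_nonneg_nonneg[OF st] f(1)] chapman_kolmogorov[OF P st]
    using prob f S.finite_measure_axioms
    by (intro integral_bind[where B' = 1 and B = K, OF _ _ kernel]) (auto simp: prob_space.emeasure_space_1)
  have e': "\<bar>?T y - f y\<bar> \<le> e" for y
    using e[of y] by (simp add: semigroup_op_transition[OF P st(2) f(1)])
  have intf: "integrable (transition P F s x) f"
    using f by (intro S.integrable_const_bound[where B = K]) (auto cong: measurable_cong_sets)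
  have "?T \<in> borel_measurable borel"
    using measurable_compose[OF measurable_transition[OF P st(2)] integral_measurable_subprob_algebra[OF f(1)]]
    by simp
  then have intT: "integrable (transition P F s x) ?T"
  proof (intro S.integrable_const_bound[where B = "e + K"])
    show "AE y in transition P F s x. norm (?T y) \<le> e + K"
    proof (rule AE_I2)
      fix y show "norm (?T y) \<le> e + K"
        using e'[of y] f(2)[of y] by simp
    qed
  qed (simp cong: measurable_cong_sets)
  have "\<bar>semigroup_op P F (s + t) f x - semigroup_op P F s f x\<bar>
      = \<bar>LINT y|transition P F s x. ?T y - f y\<bar>"
    using intf intT by (simp add: eq semigroup_op_transition[OF P st(1) f(1)])
  also have "\<dots> \<le> (LINT y|transition P F s x. \<bar>?T y - f y\<bar>)"
    by (rule integral_abs_bound)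
  also have "\<dots> \<le> e"
    using intf intT e' by (intro S.integral_le_const) auto
  finally show ?thesis .
qed

lemma semigroup_op_0:
  assumes "markov_process M P F" "f \<in> borel_measurable borel"
  shows "semigroup_op P F 0 f x = f x"
proof -
  interpret prob_space "P x"
    using markov_processD(1)[OF assms(1)] by simp
  have "(LINT \<omega>|P x. f (F 0 \<omega>)) = (LINT \<omega>|P x. f x)"
    using markov_processD(5)[OF assms(1), of x] measurable_compose[OF markov_processD(4)[OF assms(1)] assms(2)]
    by (intro integral_cong_AE) auto
  then show ?thesis
    by (simp add: semigroup_op_def prob_space)
qed

text \<open>
  Contractivity gives \<open>\<parallel>T\<^sub>t f - f\<parallel> \<le> n \<parallel>T\<^bsub>t/n\<^esub> f - f\<parallel>\<close>, and the right-hand side tends to \<open>t \<parallel>A f\<parallel> = 0\<close>.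
\<close>

lemma semigroup_op_const_if_generator_0:
  assumes P: "markov_process M P F"
    and gen: "has_generator P F f (\<lambda>_. 0)" and K: "\<And>x. \<bar>f x\<bar> \<le> K" and "0 \<le> t"
  shows "semigroup_op P F t f x = f x"
proof (cases "t = 0")
  case True
  then show ?thesis
    using semigroup_op_0[OF P] gen
    by (auto simp: has_generator_def C_infty_def intro: borel_measurable_continuous_onI)
next
  case False
  with \<open>0 \<le> t\<close> have "t > 0" by simp
  have f: "f \<in> borel_measurable borel"
    using gen by (auto simp: has_generator_def C_infty_def intro: borel_measurable_continuous_onI)
  have "\<bar>semigroup_op P F t f x - f x\<bar> \<le> 0 + e" if "e > 0" for e
  proof -
    \<comment> \<open>Tolerance per unit of time: each of the \<open>n\<close> steps of length
      \<open>h\<close> = \<open>t / n\<close> costs at most \<open>e / t * h\<close>, which adds up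
      to \<open>e\<close>.\<close>
    have "e / t > 0"
      using that \<open>t > 0\<close> by simp
    then have "\<forall>\<^sub>F h in at_right 0. \<forall>x. \<bar>(semigroup_op P F h f x - f x) / h\<bar> < e / t"
      using gen unfolding has_generator_def uniform_limit_iff by (auto simp: dist_real_def)
    then obtain d where d: "d > 0"
      "\<And>h x. 0 < h \<Longrightarrow> h < d \<Longrightarrow> \<bar>(semigroup_op P F h f x - f x) / h\<bar> < e / t"
      by (auto simp: eventually_at_right_field)
    obtain n where n: "t / d < real n"
      using reals_Archimedean2 by blast
    then have "n > 0"
      using \<open>t > 0\<close> d(1) by (cases n) (auto simp: field_simps)
    define h where "h = t / real n"
    have h: "0 < h" "h < d" "real n * h = t"
      using n \<open>n > 0\<close> \<open>t > 0\<close> d(1) by (auto simp: h_def field_simps)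
    define r where "r = e / t * h"
    have step: "\<bar>semigroup_op P F h f y - f y\<bar> \<le> r" for y
      using d(2)[OF h(1,2), of y] h(1) by (simp add: r_def field_simps)
    have "\<bar>semigroup_op P F (real m * h) f x - f x\<bar> \<le> real m * r" for m
    proof (induction m)
      case 0
      then show ?case
        by (simp add: semigroup_op_0[OF P f])
    next
      case (Suc m)
      have incr: "\<bar>semigroup_op P F (real m * h + h) f x - semigroup_op P F (real m * h) f x\<bar> \<le> r"
        using h by (intro semigroup_op_increment[OF P _ _ f K step]) auto
      have Suc_mult: "real (Suc m) * z = real m * z + z" for z
        by (simp add: distrib_right)
      show ?case
        unfolding Suc_mult using Suc incr by linarith
    qed
    from this[of n] show ?thesis
      using h \<open>t > 0\<close> by (simp add: r_def mult.left_commute)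
  qed
  then have "\<bar>semigroup_op P F t f x - f x\<bar> \<le> 0"
    by (rule field_le_epsilon)
  then show ?thesis
    by simp
qed

section \<open>The symbol of a nice Feller process does not vanish near the origin\<close>

text \<open>Uniform convergence implies pointwise convergence, whose limits are unique; this
  justifies the \<open>THE\<close> in \<open>generator\<close>.\<close>

lemma has_generator_unique:
  assumes "has_generator P F f g" "has_generator P F f h"
  shows "g = h"
proof
  fix x
  have "((\<lambda>t. (semigroup_op P F t f x - f x) / t) \<longlongrightarrow> g x) (at_right 0)"
    "((\<lambda>t. (semigroup_op P F t f x - f x) / t) \<longlongrightarrow> h x) (at_right 0)"
    using assms unfolding has_generator_def by (auto dest: tendsto_uniform_limitI)
  then show "g x = h x"
    by (intro tendsto_unique[OF trivial_limit_at_right_real])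
qed

lemma has_generator_generator:
  assumes "f \<in> generator_domain P F"
  shows "has_generator P F f (generator P F f)"
proof -
  obtain g where g: "has_generator P F f g"
    using assms by (auto simp: generator_domain_def)
  then have "generator P F f = g"
    unfolding generator_def by (intro the_equality g has_generator_unique[OF _ g])
  with g show ?thesis
    by simp
qed

section \<open>Elementary properties of the symbol and of its supremum and infimum\<close>

lemma symbol_levy_khintchine:
  assumes "nice_feller_process M P F q"
  obtains a b c \<nu> where "\<And>x. 0 \<le> a x" "\<And>x \<xi>. 0 \<le> \<xi> \<bullet> (c x *v \<xi>)"
    "\<And>x. sets (\<nu> x) = sets borel" "\<And>x. (\<integral>\<^sup>+y. ennreal (min 1 ((norm y)\<^sup>2)) \<partial>\<nu> x) < \<infinity>"
    "\<And>x \<xi>. q x \<xi> = levy_khintchine (a x) (b x) (c x) (\<nu> x) \<xi>"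
proof -
  have "is_symbol P F q"
    using assms by (simp add: nice_feller_process_def)
  then show thesis
    unfolding is_symbol_def levy_kernel_def
    by (elim conjE exE) (rule that; simp)
qed

text \<open>The growth condition bounds the symbol uniformly in \<open>x\<close>, so the real-valued
  \<open>SUP\<close> is a genuine upper bound.\<close>

lemma cmod_le_sup_symbol:
  assumes "nice_feller_process M P F q"
  shows "cmod (q x \<xi>) \<le> sup_symbol q \<xi>"
proof -
  obtain C where "\<And>\<xi> x. cmod (q x \<xi>) \<le> C * (1 + (norm \<xi>)\<^sup>2)"
    using assms by (auto simp: nice_feller_process_def)
  then show ?thesis
    unfolding sup_symbol_def by (intro cSUP_upper bdd_aboveI2) auto
qed

lemma sup_symbol_nonneg: "nice_feller_process M P F q \<Longrightarrow> 0 \<le> sup_symbol q \<xi>"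
  by (rule order_trans[OF norm_ge_zero cmod_le_sup_symbol])

lemma inf_Re_symbol_nonneg:
  assumes "nice_feller_process M P F q"
  shows "0 \<le> inf_Re_symbol q \<xi>"
proof -
  have "0 \<le> Re (q x \<xi>)" for x
    using assms by (rule symbol_levy_khintchine) (simp add: Re_levy_khintchine_nonneg)
  then show ?thesis
    unfolding inf_Re_symbol_def by (intro cINF_greatest) auto
qed

lemma symbol_at_0:
  assumes "nice_feller_process M P F q"
  shows "sup_symbol q 0 = 0" "inf_Re_symbol q 0 = 0"
  using assms by (simp_all add: nice_feller_process_def sup_symbol_def inf_Re_symbol_def)

text \<open>For a zero symbol the bump at the origin has generator 0, hence constant expectation in
  time. Started at its maximum, the process then stays there almost surely at each time, so it
  spends no time in the complement of the origin, a nonempty open set.\<close>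

lemma symbol_nonzero:
  fixes P :: "real^'n \<Rightarrow> 'w measure"
  assumes "nice_feller_process M P F q"
  shows "\<exists>x \<xi>. q x \<xi> \<noteq> 0"
proof (rule ccontr)
  assume "\<nexists>x \<xi>. q x \<xi> \<noteq> 0"
  then have q0: "q x \<xi> = 0" for x \<xi> by blast
  have P: "markov_process M P F" and dom: "Cc_infty \<subseteq> generator_domain P F"
    and sym: "is_symbol P F q"
    using assms by (auto simp: nice_feller_process_def feller_process_def)
  define f :: "real^'n \<Rightarrow> real" where "f x = flat 0 (1 - (x - 0) \<bullet> (x - 0))" for x
  have f: "f \<in> Cc_infty"
    unfolding f_def by (rule bump_in_Cc_infty)
  have "generator P F f = (\<lambda>_. 0)"
    using sym f by (auto simp: is_symbol_def q0 fun_eq_iff)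
  with has_generator_generator[of f P F] f dom have gen: "has_generator P F f (\<lambda>_. 0)"
    by auto
  have f_meas: "f \<in> borel_measurable borel"
    using gen by (auto simp: has_generator_def C_infty_def intro: borel_measurable_continuous_onI)
  have bound: "\<bar>f x\<bar> \<le> 1" for x
    by (auto simp: f_def flat_def)
  have f_le: "f x \<le> f 0" for x
    using bump_less[of x 0] by (cases "x = 0") (auto simp: f_def)
  have const: "AE \<omega> in P 0. F t \<omega> = 0" if "0 \<le> t" for t
  proof -
    interpret prob_space "P 0"
      using markov_processD(1)[OF P] by simp
    have m: "(\<lambda>\<omega>. f (F t \<omega>)) \<in> borel_measurable (P 0)"
      by (rule measurable_compose[OF markov_processD(4)[OF P that] f_meas])
    have int: "integrable (P 0) (\<lambda>\<omega>. f (F t \<omega>))"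
      using m bound by (intro integrable_const_bound[where B = 1]) auto
    \<comment> \<open>The integrand is nonnegative because 0 is the maximum point, so a zero
      integral makes it vanish almost surely.\<close>
    have "(LINT \<omega>|P 0. f 0 - f (F t \<omega>)) = 0"
      using semigroup_op_const_if_generator_0[OF P gen bound that, of 0] int
      by (simp add: semigroup_op_def prob_space)
    then have "AE \<omega> in P 0. f 0 - f (F t \<omega>) = 0"
      using int f_le by (subst (asm) integral_nonneg_eq_0_iff_AE) auto
    then show ?thesis
    proof eventually_elim
      case (elim \<omega>)
      then show ?case
        using bump_less[of "F t \<omega>" 0] by (force simp: f_def)
    qed
  qed
  obtain \<psi> where \<psi>: "maximal_irreducibility_measure M P F \<psi>"
    "\<And>U. open U \<Longrightarrow> U \<noteq> {} \<Longrightarrow> 0 < emeasure \<psi> U"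
    using assms by (auto simp: nice_feller_process_def)
  \<comment> \<open>The maximality equivalence is applied to \<open>\<psi>\<close> itself, which is
    absolutely continuous with respect to itself.\<close>
  then have irr: "irreducible_wrt M P F \<psi>"
    by (auto simp: maximal_irreducibility_measure_def absolutely_continuous_def)
  let ?B = "- {0} :: (real^'n) set"
  have "axis undefined 1 \<in> ?B"
    by (simp add: axis_eq_0_iff)
  then have "0 < emeasure \<psi> ?B"
    by (intro \<psi>(2)) auto
  with irr have pos: "0 < (\<integral>\<^sup>+t\<in>{0..}. emeasure (P 0) {\<omega> \<in> space M. F t \<omega> \<in> ?B} \<partial>lborel)"
    by (auto simp: irreducible_wrt_def)
  have zero: "emeasure (P 0) {\<omega> \<in> space M. F t \<omega> \<in> ?B} * indicator {0..} t = 0" for t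
  proof (cases "0 \<le> t")
    case True
    have "emeasure (P 0) {\<omega> \<in> space (P 0). F t \<omega> \<in> ?B} = 0"
      by (rule emeasure_eq_0_AE) (use const[OF True] in simp)
    then show ?thesis
      by (simp add: markov_processD(3)[OF P])
  qed simp
  have "(\<integral>\<^sup>+t\<in>{0..}. emeasure (P 0) {\<omega> \<in> space M. F t \<omega> \<in> ?B} \<partial>lborel) = (\<integral>\<^sup>+t. 0 \<partial>(lborel :: real measure))"
    by (intro nn_integral_cong zero)
  with pos show False
    by simp
qed

text \<open>Excludes the degenerate alternative for concave profiles. A supremum vanishing near the
  origin makes all \<open>q x\<close> vanish on one common ball, and the Levy-Khintchine form
  spreads this to every frequency.\<close>

lemma sup_symbol_not_eventually_0:
  assumes nice: "nice_feller_process M P F q"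
  shows "\<not> (\<forall>\<^sub>F \<xi> in nhds 0. sup_symbol q \<xi> = 0)"
proof
  assume "\<forall>\<^sub>F \<xi> in nhds 0. sup_symbol q \<xi> = 0"
  then obtain \<epsilon> where \<epsilon>: "\<epsilon> > 0" "\<And>\<xi>. norm \<xi> < \<epsilon> \<Longrightarrow> sup_symbol q \<xi> = 0"
    by (auto simp: eventually_nhds_metric)
  then have near: "q x \<xi> = 0" if "norm \<xi> < \<epsilon>" for x \<xi>
    using cmod_le_sup_symbol[OF nice, of x \<xi>] that by simp
  obtain a b c \<nu> where lk: "\<And>x. 0 \<le> a x" "\<And>x \<xi>. 0 \<le> \<xi> \<bullet> (c x *v \<xi>)"
    "\<And>x. sets (\<nu> x) = sets borel" "\<And>x. (\<integral>\<^sup>+y. ennreal (min 1 ((norm y)\<^sup>2)) \<partial>\<nu> x) < \<infinity>"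
    and q: "\<And>x \<xi>. q x \<xi> = levy_khintchine (a x) (b x) (c x) (\<nu> x) \<xi>"
    using symbol_levy_khintchine[OF nice] by metis
  have "q x \<xi> = 0" for x \<xi>
    unfolding q by (rule levy_khintchine_eq_0[OF lk(3,4,1,2) \<epsilon>(1) near[unfolded q]])
  with symbol_nonzero[OF nice] show False
    by blast
qed

section \<open>The four assertions, assembled from the growth lemmas\<close>

theorem theorem2p13:
  fixes M :: "'w measure"
    and P :: "real^'n \<Rightarrow> 'w measure"
    and F :: "real \<Rightarrow> 'w \<Rightarrow> real^'n"
    and q :: "real^'n \<Rightarrow> real^'n \<Rightarrow> complex"
  assumes "nice_feller_process M P F q"
  shows "(CARD('n) = 1 \<and> radial_convex_near_0 (sup_symbol q) \<and>
            (\<exists>r>0. (\<integral>\<^sup>+\<xi>\<in>ball 0 r. 1 / ennreal (sup_symbol q \<xi>) \<partial>lborel) = \<infinity>)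
            \<longrightarrow> pruitt_beta q \<ge> 1)
       \<and> (radial_concave_near_0 (sup_symbol q) \<longrightarrow> pruitt_beta q \<le> 1)
       \<and> (radial_concave_near_0 (inf_Re_symbol q) \<and> CARD('n) \<ge> 2 \<and>
            pruitt_delta q < of_nat CARD('n)
            \<longrightarrow> (\<exists>r>0. (\<integral>\<^sup>+\<xi>\<in>ball 0 r. 1 / ennreal (inf_Re_symbol q \<xi>) \<partial>lborel) < \<infinity>))
       \<and> (radial_convex_near_0 (inf_Re_symbol q) \<longrightarrow> pruitt_delta q \<ge> 1)"
proof (intro conjI impI)
  note sup = symbol_at_0(1)[OF assms] sup_symbol_nonneg[OF assms]
  note inf = symbol_at_0(2)[OF assms] inf_Re_symbol_nonneg[OF assms]
  show "pruitt_beta q \<ge> 1"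
    if "CARD('n) = 1 \<and> radial_convex_near_0 (sup_symbol q) \<and>
      (\<exists>r>0. (\<integral>\<^sup>+\<xi>\<in>ball 0 r. 1 / ennreal (sup_symbol q \<xi>) \<partial>lborel) = \<infinity>)"
    unfolding pruitt_beta_def using that by (intro radial_convex_index_ge_1 sup) auto
  show "pruitt_delta q \<ge> 1" if "radial_convex_near_0 (inf_Re_symbol q)"
    unfolding pruitt_delta_def using that by (intro radial_convex_index_ge_1 inf)
  show "pruitt_beta q \<le> 1" if concave: "radial_concave_near_0 (sup_symbol q)"
  proof -
    obtain c s where "c > 0" "s > 0" "\<And>\<xi>. norm \<xi> \<le> s \<Longrightarrow> c * norm \<xi> \<le> sup_symbol q \<xi>"
      using radial_concave_linear_lower_bound[OF concave sup] sup_symbol_not_eventually_0[OF assms]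
      by blast
    then show ?thesis
      unfolding pruitt_beta_def by (rule linear_lower_bound_index_le_1)
  qed
  show "\<exists>r>0. (\<integral>\<^sup>+\<xi>\<in>ball 0 r. 1 / ennreal (inf_Re_symbol q \<xi>) \<partial>lborel) < \<infinity>"
    if asm: "radial_concave_near_0 (inf_Re_symbol q) \<and> CARD('n) \<ge> 2 \<and>
      pruitt_delta q < of_nat CARD('n)"
  proof -
    \<comment> \<open>Here \<delta> < d excludes the degenerate alternative, in which the index
      would be infinite.\<close>
    have "\<not> (\<forall>\<^sub>F \<xi> in nhds 0. inf_Re_symbol q \<xi> = 0)"
    proof
      assume "\<forall>\<^sub>F \<xi> in nhds 0. inf_Re_symbol q \<xi> = 0"
      then have "pruitt_delta q = \<infinity>"
        unfolding pruitt_delta_def by (rule eventually_zero_index_infinite)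
      with asm show False
        by simp
    qed
    then obtain c s where "c > 0" "s > 0" "\<And>\<xi>. norm \<xi> \<le> s \<Longrightarrow> c * norm \<xi> \<le> inf_Re_symbol q \<xi>"
      using radial_concave_linear_lower_bound[OF conjunct1[OF asm] inf] by blast
    then show ?thesis
      using asm by (intro linear_lower_bound_nn_integral_finite[where c = c and s = s]) auto
  qed
qed

end
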